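(* Consider the communication game $\mathbb{G}_{\mathscr{B}}$ associated with a Bell inequality $\mathscr{B}$ (both defined in the context). The maximum of the average payoff $I^{cc}_{\mathbb{G}_{\mathscr{B}}}(m,b)$ over all classical strategies $(m,b)$ is achieved by a linear strategy. Moreover, for every nonlinear classical strategy $(m,b)$, the value $I^{cc}_{\mathbb{G}_{\mathscr{B}}}(m,b)$ is a convex combination (probabilistic mixture) of values $I^{cc}_{\mathbb{G}_{\mathscr{B}}}(m',b')$ of linear strategies $(m',b')$.
   Context: **Bell inequality $\mathscr{B}$.** Fix integers $d\ge 2$, $m_A,m_B\ge 1$, $N\ge 1$, $K\ge 0$. Let $x\in\{0,\dots,m_A-1\}$, $y\in\{0,\dots,m_B-1\}$ and let $p(x,y)$ be a probability distribution on such pairs. For all $x,y$ and $i\in\{1,\dots,N\}$ let $F^i_{xy}:\{0,\dots,K\}\to\{0,\dots,d-1\}$ be functions such that, for each fixed $(x,y)$, the values $F^i_{xy}(k)$ for distinct pairs $(i,k)$ are distinct (i.e. the sets $S^{i,k}_{xy}=\{(a,b): a+b=F^i_{xy}(k) \bmod d\}$ are pairwise disjoint). Let $c^{i,k}_{xy}$ be real numbers. These data define the Bell inequality $\mathscr{B}$: $\sum_{x,y}p(x,y)\sum_{k=0}^K\sum_{i=1}^N c^{i,k}_{xy}P_{xy}(a+b=F^i_{xy}(k) \bmod d)\le B$, with $B$ its classical (local realistic) bound and $a,b\in\{0,\dots,d-1\}$ the local outcomes. **Game $\mathbb{G}_{\mathscr{B}}$.** Alice receives $x_0\in\{0,\dots,d-1\}$,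 uniformly distributed and independent of $(x,y)$, and $x$; Bob receives $y$; $(x,y)$ is distributed according to $p(x,y)$. Alice sends Bob a message $m\in\{0,\dots,d-1\}$, and Bob outputs a guess $G\in\{0,\dots,d-1\}$. If $G=x_0+F^i_{xy}(k)\bmod d$, they earn the payoff $c^{i,k}_{xy}$. **Classical strategies.** A classical strategy is a pair $(m,b)$ of functions $m=m(x_0,x)\in\{0,\dots,d-1\}$ and $b=b(y)\in\{0,\dots,d-1\}$; Bob's guess is restricted to be of the form $G=m(x_0,x)+b(y)\bmod d$. The strategy is *linear* if $m(x_0,x)=x_0+a(x)\bmod d$ for some function $a$ of $x$ with values in $\{0,\dots,d-1\}$; otherwise it is *nonlinear*. Its average payoff is $$I^{cc}_{\mathbb{G}_{\mathscr{B}}}(m,b)=\frac1d\sum_{x_0,x,y}p(x,y)\sum_{k=0}^K\sum_{i=1}^N c^{i,k}_{xy}\,\mathbf 1\big[m(x_0,x)+b(y)=x_0+F^i_{xy}(k)\bmod d\big].$$ *)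

theory Defs
  imports "HOL-Probability.Probability"
begin

text \<open>
  Settings and outcomes are natural numbers below \<open>mA\<close>, \<open>mB\<close> and \<open>d\<close>; functions are
  constrained on these ranges only.  The coefficient \<open>c\<^sup>i\<^sup>,\<^sup>k\<^sub>x\<^sub>y\<close> is written \<open>c x y i k\<close>, and
  \<open>F\<^sup>i\<^sub>x\<^sub>y(k)\<close> is written \<open>F x y i k\<close>.
\<close>

section \<open>The Bell inequality\<close>

text \<open>
  A behaviour \<open>P\<close> gives, for each pair of settings, the joint distribution of the outcomes
  \<open>(a, b)\<close>.  It is local realistic if the outcomes are produced independently given the settings
  and a shared hidden variable \<open>l\<close>.  With finitely many settings and outcomes,
  a countable hidden variable is no restriction.
\<close>

definition local_behaviours ::
    "nat \<Rightarrow> nat \<Rightarrow> nat \<Rightarrow> (nat \<Rightarrow> nat \<Rightarrow> (nat \<times> nat) pmf) set" where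
  "local_behaviours d mA mB =
    {(\<lambda>x y. bind_pmf q (\<lambda>l. pair_pmf (PA l x) (PB l y))) | (q :: nat pmf) PA PB.
       (\<forall>l. \<forall>x<mA. set_pmf (PA l x) \<subseteq> {..<d}) \<and> (\<forall>l. \<forall>y<mB. set_pmf (PB l y) \<subseteq> {..<d})}"

definition bell_value ::
    "nat \<Rightarrow> nat \<Rightarrow> nat \<Rightarrow> nat \<Rightarrow> nat \<Rightarrow> (nat \<times> nat) pmf \<Rightarrow> (nat \<Rightarrow> nat \<Rightarrow> nat \<Rightarrow> nat \<Rightarrow> nat) \<Rightarrow>
     (nat \<Rightarrow> nat \<Rightarrow> nat \<Rightarrow> nat \<Rightarrow> real) \<Rightarrow> (nat \<Rightarrow> nat \<Rightarrow> (nat \<times> nat) pmf) \<Rightarrow> real" where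
  "bell_value d mA mB N K p F c P =
    (\<Sum>x<mA. \<Sum>y<mB. pmf p (x, y) *
      (\<Sum>k=0..K. \<Sum>i=1..N. c x y i k *
        measure_pmf.prob (P x y) {(a, b). (a + b) mod d = F x y i k}))"

locale bell_inequality =
  fixes d mA mB N K :: nat
    and p :: "(nat \<times> nat) pmf"
    and F :: "nat \<Rightarrow> nat \<Rightarrow> nat \<Rightarrow> nat \<Rightarrow> nat"
    and c :: "nat \<Rightarrow> nat \<Rightarrow> nat \<Rightarrow> nat \<Rightarrow> real"
    and B :: real
  assumes d_ge_2: "d \<ge> 2"
    and mA_ge_1: "mA \<ge> 1"
    and mB_ge_1: "mB \<ge> 1"
    and N_ge_1: "N \<ge> 1"
    and p_support: "set_pmf p \<subseteq> {..<mA} \<times> {..<mB}"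
    and F_range: "\<And>x y i k. x < mA \<Longrightarrow> y < mB \<Longrightarrow> i \<in> {1..N} \<Longrightarrow> k \<in> {0..K} \<Longrightarrow> F x y i k < d"
    and F_distinct: "\<And>x y. x < mA \<Longrightarrow> y < mB \<Longrightarrow> inj_on (\<lambda>(i, k). F x y i k) ({1..N} \<times> {0..K})"
    and B_classical_bound:
      "B = (SUP P \<in> local_behaviours d mA mB. bell_value d mA mB N K p F c P)"


section \<open>The communication game\<close>

definition classical_strategy ::
    "nat \<Rightarrow> nat \<Rightarrow> nat \<Rightarrow> (nat \<Rightarrow> nat \<Rightarrow> nat) \<Rightarrow> (nat \<Rightarrow> nat) \<Rightarrow> bool" where
  "classical_strategy d mA mB m b \<longleftrightarrow>
    m \<in> {..<d} \<rightarrow> {..<mA} \<rightarrow> {..<d} \<and> b \<in> {..<mB} \<rightarrow> {..<d}"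

definition linear_message :: "nat \<Rightarrow> nat \<Rightarrow> (nat \<Rightarrow> nat \<Rightarrow> nat) \<Rightarrow> bool" where
  "linear_message d mA m \<longleftrightarrow>
    (\<exists>a \<in> {..<mA} \<rightarrow> {..<d}. \<forall>x0<d. \<forall>x<mA. m x0 x = (x0 + a x) mod d)"

text \<open>
  By the distinctness of the values of \<open>F\<close>, at most one summand of the payoff is nonzero.
  A guess matching none of them earns \<open>0\<close>.
\<close>

definition guess_payoff ::
    "nat \<Rightarrow> nat \<Rightarrow> nat \<Rightarrow> (nat \<Rightarrow> nat \<Rightarrow> nat \<Rightarrow> nat \<Rightarrow> nat) \<Rightarrow>
     (nat \<Rightarrow> nat \<Rightarrow> nat \<Rightarrow> nat \<Rightarrow> real) \<Rightarrow> nat \<Rightarrow> nat \<Rightarrow> nat \<Rightarrow> nat \<Rightarrow> real" where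
  "guess_payoff d N K F c x0 x y G =
    (\<Sum>k=0..K. \<Sum>i=1..N. c x y i k * of_bool (G = (x0 + F x y i k) mod d))"

definition average_payoff ::
    "nat \<Rightarrow> nat \<Rightarrow> nat \<Rightarrow> nat \<Rightarrow> nat \<Rightarrow> (nat \<times> nat) pmf \<Rightarrow> (nat \<Rightarrow> nat \<Rightarrow> nat \<Rightarrow> nat \<Rightarrow> nat) \<Rightarrow>
     (nat \<Rightarrow> nat \<Rightarrow> nat \<Rightarrow> nat \<Rightarrow> real) \<Rightarrow> (nat \<Rightarrow> nat \<Rightarrow> nat) \<Rightarrow> (nat \<Rightarrow> nat) \<Rightarrow> real" where
  "average_payoff d mA mB N K p F c m b =
    1 / real d * (\<Sum>x0<d. \<Sum>x<mA. \<Sum>y<mB.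
      pmf p (x, y) * guess_payoff d N K F c x0 x y ((m x0 x + b y) mod d))"

end

theory Submission
  imports Defs "HOL-Number_Theory.Cong"
begin

text \<open>
  The payoff depends on the guess \<open>G\<close> and on \<open>x\<^sub>0\<close> only through \<open>G - x\<^sub>0\<close> modulo \<open>d\<close>.  Hence for a
  fixed input \<open>z\<close> the message \<open>m(z, x)\<close> earns what the linear strategy with
  \<open>a\<^sub>z(x) = m(z, x) - z\<close> earns for every \<open>x\<^sub>0\<close>, so the payoff of \<open>(m, b)\<close> is the uniform mixture
  over \<open>z\<close> of the payoffs of the linear strategies \<open>(a\<^sub>z, b)\<close>.  The linear payoffs form a finite
  set, whose maximum therefore bounds every payoff.
\<close>

text \<open>Translation by \<open>x0\<close> is injective modulo \<open>d\<close>, so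
  \<open>x0\<close> cancels from both sides of each test
  \<open>G = (x0 + F x y i k) mod d\<close>.\<close>

lemma guess_payoff_shift:
  "guess_payoff d N K F c x0 x y ((x0 + u) mod d) = guess_payoff d N K F c 0 x y (u mod d)"
proof -
  have "(x0 + u) mod d = (x0 + v) mod d \<longleftrightarrow> u mod d = v mod d" for v
    using cong_add_lcancel_nat[of x0 u v d] by (simp add: cong_def)
  then show ?thesis
    by (simp add: guess_payoff_def)
qed

text \<open>No average over \<open>x0\<close> appears, since under a linear message every
  \<open>x0\<close> contributes the same amount. The values of \<open>a\<close> need not lie below
  \<open>d\<close>, so unreduced shifts can be inserted.\<close>

definition linear_payoff ::
    "nat \<Rightarrow> nat \<Rightarrow> nat \<Rightarrow> nat \<Rightarrow> nat \<Rightarrow> (nat \<times> nat) pmf \<Rightarrow> (nat \<Rightarrow> nat \<Rightarrow> nat \<Rightarrow> nat \<Rightarrow> nat) \<Rightarrow>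
     (nat \<Rightarrow> nat \<Rightarrow> nat \<Rightarrow> nat \<Rightarrow> real) \<Rightarrow> (nat \<Rightarrow> nat) \<Rightarrow> (nat \<Rightarrow> nat) \<Rightarrow> real" where
  "linear_payoff d mA mB N K p F c a b =
    (\<Sum>x<mA. \<Sum>y<mB. pmf p (x, y) * guess_payoff d N K F c 0 x y ((a x + b y) mod d))"

text \<open>Used to replace \<open>a\<close> and \<open>b\<close> by their residues and to cut them
  down to the actual settings.\<close>

lemma linear_payoff_cong:
  assumes "\<And>x. x < mA \<Longrightarrow> a x mod d = a' x mod d"
    and "\<And>y. y < mB \<Longrightarrow> b y mod d = b' y mod d"
  shows "linear_payoff d mA mB N K p F c a b = linear_payoff d mA mB N K p F c a' b'"
proof -
  have "(a x + b y) mod d = (a' x + b' y) mod d" if "x < mA" "y < mB" for x y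
    using assms that by (metis mod_add_eq)
  then show ?thesis
    unfolding linear_payoff_def by (intro sum.cong) auto
qed

text \<open>The difference \<open>m(z, x) - z\<close> is taken as \<open>m z x + (d - z)\<close> to avoid truncation.\<close>

lemma average_payoff_eq_mean_linear_payoff:
  "average_payoff d mA mB N K p F c m b =
    (\<Sum>z<d. 1 / real d * linear_payoff d mA mB N K p F c (\<lambda>x. m z x + (d - z)) b)"
proof -
  have "guess_payoff d N K F c z x y ((m z x + b y) mod d) =
      guess_payoff d N K F c 0 x y ((m z x + (d - z) + b y) mod d)" if "z < d" for z x y
  proof -
    \<comment> \<open>Adding \<open>z\<close> back completes \<open>d - z\<close> to a full period,
      which disappears modulo \<open>d\<close>.\<close>
    have "z + (m z x + (d - z) + b y) = m z x + b y + d"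
      using that by simp
    then have "(m z x + b y) mod d = (z + (m z x + (d - z) + b y)) mod d"
      by (simp only: mod_add_self2)
    then show ?thesis
      by (simp only: guess_payoff_shift)
  qed
  then show ?thesis
    by (simp add: average_payoff_def linear_payoff_def sum_distrib_left)
qed

text \<open>For a linear message the shift \<open>m z x - z\<close> is \<open>a x\<close> modulo
  \<open>d\<close> for every \<open>z\<close>, so the mean is taken over \<open>d\<close> equal
  terms.\<close>

lemma average_payoff_linear:
  assumes "d > 0" and "\<And>x0 x. x0 < d \<Longrightarrow> x < mA \<Longrightarrow> m x0 x = (x0 + a x) mod d"
  shows "average_payoff d mA mB N K p F c m b = linear_payoff d mA mB N K p F c a b"
proof -
  have "linear_payoff d mA mB N K p F c (\<lambda>x. m z x + (d - z)) b =
      linear_payoff d mA mB N K p F c a b" if "z < d" for z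
  proof (rule linear_payoff_cong)
    fix x assume "x < mA"
    then have "(m z x + (d - z)) mod d = ((z + a x) mod d + (d - z)) mod d"
      using assms(2) that by simp
    also have "\<dots> = (z + a x + (d - z)) mod d"
      by (rule mod_add_left_eq)
    also have "z + a x + (d - z) = a x + d"
      using that by simp
    finally show "(m z x + (d - z)) mod d = a x mod d"
      by simp
  qed simp
  then show ?thesis
    using \<open>d > 0\<close> by (simp add: average_payoff_eq_mean_linear_payoff)
qed

text \<open>Strategies are arbitrary off the settings, so there are infinitely many of them.
  Indexing the values by extensional functions makes it visible that they form a finite nonempty
  set.\<close>

lemma linear_payoffs_eq:
  assumes "d > 0"
  shows "{average_payoff d mA mB N K p F c m b | m b.
      classical_strategy d mA mB m b \<and> linear_message d mA m} =
    (\<lambda>(a, b). linear_payoff d mA mB N K p F c a b) ` (({..<mA} \<rightarrow>\<^sub>E {..<d}) \<times> ({..<mB} \<rightarrow>\<^sub>E {..<d}))"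
    (is "?V = ?L")
proof (intro equalityI subsetI)
  fix v assume "v \<in> ?V"
  then obtain m b a where v: "v = average_payoff d mA mB N K p F c m b"
    and b: "b \<in> {..<mB} \<rightarrow> {..<d}" and a: "a \<in> {..<mA} \<rightarrow> {..<d}"
    and m: "\<forall>x0<d. \<forall>x<mA. m x0 x = (x0 + a x) mod d"
    unfolding classical_strategy_def linear_message_def by blast
  have "v = linear_payoff d mA mB N K p F c a b"
    unfolding v using \<open>d > 0\<close> m by (intro average_payoff_linear) auto
  also have "\<dots> = linear_payoff d mA mB N K p F c (restrict a {..<mA}) (restrict b {..<mB})"
    by (rule linear_payoff_cong) auto
  finally show "v \<in> ?L"
    using a b by (intro image_eqI[of _ _ "(restrict a {..<mA}, restrict b {..<mB})"]) auto
next
  fix v assume "v \<in> ?L"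
  then obtain a b where a: "a \<in> {..<mA} \<rightarrow>\<^sub>E {..<d}" and b: "b \<in> {..<mB} \<rightarrow>\<^sub>E {..<d}"
    and v: "v = linear_payoff d mA mB N K p F c a b"
    by auto
  let ?m = "\<lambda>x0 x. (x0 + a x) mod d"
  have "v = average_payoff d mA mB N K p F c ?m b"
    unfolding v using \<open>d > 0\<close> by (intro average_payoff_linear[symmetric]) auto
  moreover have "classical_strategy d mA mB ?m b"
    using \<open>d > 0\<close> b by (auto simp: classical_strategy_def PiE_def)
  moreover have "linear_message d mA ?m"
    using a by (auto simp: linear_message_def PiE_def intro!: bexI[of _ a])
  ultimately show "v \<in> ?V"
    by blast
qed

lemma average_payoff_in_convex_hull_linear:
  assumes "d > 0" and b: "b \<in> {..<mB} \<rightarrow> {..<d}"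
  shows "average_payoff d mA mB N K p F c m b \<in>
    convex hull {average_payoff d mA mB N K p F c m' b' | m' b'.
      classical_strategy d mA mB m' b' \<and> linear_message d mA m'}"
    (is "_ \<in> convex hull ?V")
proof -
  have "linear_payoff d mA mB N K p F c (\<lambda>x. m z x + (d - z)) b \<in> ?V" for z
  proof -
    \<comment> \<open>The reduction modulo \<open>d\<close> brings the shift into the range of
      outcomes, and the restriction makes it extensional.\<close>
    let ?a = "restrict (\<lambda>x. (m z x + (d - z)) mod d) {..<mA}"
    have "linear_payoff d mA mB N K p F c (\<lambda>x. m z x + (d - z)) b =
        linear_payoff d mA mB N K p F c ?a (restrict b {..<mB})"
      by (rule linear_payoff_cong) auto
    then show ?thesis
      unfolding linear_payoffs_eq[OF \<open>d > 0\<close>] using \<open>d > 0\<close> b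
      by (intro image_eqI[of _ _ "(?a, restrict b {..<mB})"]) auto
  qed
  then have hull: "linear_payoff d mA mB N K p F c (\<lambda>x. m z x + (d - z)) b \<in> convex hull ?V" for z
    by (rule hull_inc)
  \<comment> \<open>The \<open>d\<close> weights \<open>1 / real d\<close> are nonnegative and sum
    to 1.\<close>
  have "(\<Sum>z<d. (1 / real d) *\<^sub>R linear_payoff d mA mB N K p F c (\<lambda>x. m z x + (d - z)) b)
      \<in> convex hull ?V"
    using \<open>d > 0\<close> by (intro convex_sum) (rule hull | simp)+
  then show ?thesis
    by (simp add: average_payoff_eq_mean_linear_payoff)
qed

theorem theorem1:
  fixes d mA mB N K :: nat
    and p :: "(nat \<times> nat) pmf"
    and F :: "nat \<Rightarrow> nat \<Rightarrow> nat \<Rightarrow> nat \<Rightarrow> nat"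
    and c :: "nat \<Rightarrow> nat \<Rightarrow> nat \<Rightarrow> nat \<Rightarrow> real"
    and B :: real
  assumes "bell_inequality d mA mB N K p F c B"
  shows "(\<exists>m b. classical_strategy d mA mB m b \<and> linear_message d mA m \<and>
            (\<forall>m' b'. classical_strategy d mA mB m' b' \<longrightarrow>
               average_payoff d mA mB N K p F c m' b' \<le> average_payoff d mA mB N K p F c m b)) \<and>
         (\<forall>m b. classical_strategy d mA mB m b \<and> \<not> linear_message d mA m \<longrightarrow>
            average_payoff d mA mB N K p F c m b \<in>
              convex hull {average_payoff d mA mB N K p F c m' b' | m' b'.
                             classical_strategy d mA mB m' b' \<and> linear_message d mA m'})"
proof -
  let ?V = "{average_payoff d mA mB N K p F c m b | m b.
    classical_strategy d mA mB m b \<and> linear_message d mA m}"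
  have "d > 0"
    using bell_inequality.d_ge_2[OF assms] by simp
  have hull: "average_payoff d mA mB N K p F c m b \<in> convex hull ?V"
    if "classical_strategy d mA mB m b" for m b
    using that \<open>d > 0\<close>
    by (intro average_payoff_in_convex_hull_linear) (auto simp: classical_strategy_def)
  have "finite ?V"
    unfolding linear_payoffs_eq[OF \<open>d > 0\<close>]
    by (intro finite_imageI finite_cartesian_product finite_PiE) auto
  moreover have "?V \<noteq> {}"
    unfolding linear_payoffs_eq[OF \<open>d > 0\<close>] using \<open>d > 0\<close> by (auto simp: PiE_eq_empty_iff)
  ultimately have "Max ?V \<in> ?V" and "?V \<subseteq> {..Max ?V}"
    by (rule Max_in, intro subsetI, simp only: atMost_iff Max_ge \<open>finite ?V\<close>)
  then obtain m b where "classical_strategy d mA mB m b" "linear_message d mA m"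
    and Max: "Max ?V = average_payoff d mA mB N K p F c m b"
    by blast
  \<comment> \<open>A half-line is convex, so mixtures of linear payoffs cannot exceed the largest
    one; this turns hull membership into optimality.\<close>
  moreover have "convex hull ?V \<subseteq> {..Max ?V}"
    using \<open>?V \<subseteq> {..Max ?V}\<close> by (intro hull_minimal) auto
  then have "average_payoff d mA mB N K p F c m' b' \<le> average_payoff d mA mB N K p F c m b"
    if "classical_strategy d mA mB m' b'" for m' b'
    using hull[OF that] unfolding Max by auto
  ultimately show ?thesis
    using hull by blast
qed

end
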